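(* Suppose $c=bb'$. Then the $q$-Appell series $$f(x,y)= \sum_{m=0}^\infty \sum_{n=0}^\infty \frac{(a;q)_{m+n}(b;q)_m (b';q)_n}{(c;q)_{m+n}(q;q)_m(q;q)_n}x^my^n$$ satisfies $$(aqx-b')(aqy-b)f(q^2 x,q^2y) -\{ aq(q+1) xy - q(a+b)x-q(a+b')y +(bb' +q) \} f(qx,qy) +q(x-1)(y-1)f(x,y) =0 .$$
   Context: Here $q$ is a nonzero complex number that is not a root of unity, and $a,b,b',c$ are complex parameters with $(c;q)_n\neq 0$ for all $n\ge 0$. The $q$-Pochhammer symbol is $(a;q)_0=1$, $(a;q)_n=(1-a)(1-aq)\cdots(1-aq^{n-1})$ for $n\ge 1$. Infinite sums are treated formally and convergence is not discussed: $f$ is a formal power series in $x,y$, and the equation is an identity of formal power series. *)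

theory Defs
  imports Complex_Main "HOL-Computational_Algebra.Formal_Power_Series"
begin

unbundle fps_syntax

definition qpoch :: "complex \<Rightarrow> complex \<Rightarrow> nat \<Rightarrow> complex" where
  "qpoch a q n = (\<Prod>k<n. 1 - a * q ^ k)"

text \<open>
  Formal power series in two variables \<open>x\<close>, \<open>y\<close> are elements of \<open>\<complex>[[y]][[x]]\<close>:
  \<open>F $ m $ n\<close> is the coefficient of \<open>x\<^sup>m y\<^sup>n\<close> (lemma \<open>monom2_nth\<close>).
\<close>

type_synonym fps2 = "complex fps fps"

definition const2 :: "complex \<Rightarrow> fps2" where
  "const2 c = fps_const (fps_const c)"

definition X2 :: fps2 where
  "X2 = fps_X"

definition Y2 :: fps2 where
  "Y2 = fps_const fps_X"

lemma monom2_nth: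
  "(const2 c * X2 ^ m * Y2 ^ n) $ i $ j = (if i = m \<and> j = n then c else 0)"
proof -
  have "const2 c * X2 ^ m * Y2 ^ n = fps_const (fps_const c * fps_X ^ n) * fps_X ^ m"
    by (simp add: const2_def X2_def Y2_def fps_const_power mult_ac
        flip: fps_const_mult)
  then show ?thesis
    by (simp add: fps_X_power_nth)
qed

text \<open>
  \<open>scale2 s F\<close> is \<open>F(s x, s y)\<close>: the inner composition substitutes \<open>s y\<close> for \<open>y\<close> in each
  coefficient of \<open>x\<^sup>m\<close>, the outer one substitutes \<open>s x\<close> for \<open>x\<close>.
\<close>

definition scale2 :: "complex \<Rightarrow> fps2 \<Rightarrow> fps2" where
  "scale2 s F = fps_compose (Abs_fps (\<lambda>m. fps_compose (F $ m) (fps_const s * fps_X)))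
                            (const2 s * X2)"

lemma scale2_nth: "scale2 s F $ m $ n = s ^ (m + n) * F $ m $ n"
proof -
  have inner: "fps_compose G (fps_const s * fps_X) $ n = s ^ n * G $ n" for G :: "complex fps"
    by (simp add: fps_compose_linear)
  have "scale2 s F $ m = fps_const s ^ m * fps_compose (F $ m) (fps_const s * fps_X)"
    by (simp add: scale2_def const2_def X2_def fps_compose_linear)
  then show ?thesis
    by (simp add: inner power_add mult.assoc)
qed

definition qAppell :: "complex \<Rightarrow> complex \<Rightarrow> complex \<Rightarrow> complex \<Rightarrow> complex \<Rightarrow> fps2" where
  "qAppell q a b b' c = Abs_fps (\<lambda>m. Abs_fps (\<lambda>n.
     (qpoch a q (m + n) * qpoch b q m * qpoch b' q n) /
     (qpoch c q (m + n) * qpoch q q m * qpoch q q n)))"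

end

theory Submission
  imports Defs
begin

text \<open>
  Write the coefficient of \<open>x\<^sup>m y\<^sup>n\<close> in \<open>f\<close> as \<open>w\<^sub>N s\<^sub>m t\<^sub>n\<close> with \<open>N = m + n\<close>, \<open>w\<^sub>N = (a;q)\<^sub>N / (c;q)\<^sub>N\<close>,
  \<open>s\<^sub>m = (b;q)\<^sub>m / (q;q)\<^sub>m\<close> and \<open>t\<^sub>n = (b';q)\<^sub>n / (q;q)\<^sub>n\<close>.
  Without the weight \<open>w\<close> the double series is a product of two \<open>q\<close>-binomial series. The first factor
  satisfies \<open>(1 - x) S(x) = (1 - b x) S(q x)\<close> and the second its analogue with \<open>b'\<close>, so the product
  \<open>g(x,y) = S(x) T(y)\<close> satisfies
  \<open>(1 - x) (1 - y) g(x,y) = (1 - b x) (1 - b' y) g(q x, q y)\<close>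
  (lemma \<open>qbinomial_product_recurrence\<close> compares the coefficients for \<open>m, n \<ge> 1\<close>; on the axes only
  the recurrence of a single factor is left).
  The claimed equation is this one with the weight put back. Its coefficient of \<open>x\<^sup>m y\<^sup>n\<close> factors as
  \<open>q\<close> times
  \<open>(1 - q\<^sup>N) (1 - c q\<^bsup>N-1\<^esup>) f\<^sub>m\<^sub>,\<^sub>n - (1 - a q\<^bsup>N-1\<^esup>) ((1 - b q\<^bsup>N-1\<^esup>) f\<^sub>m\<^sub>-\<^sub>1\<^sub>,\<^sub>n + (1 - b' q\<^bsup>N-1\<^esup>) f\<^sub>m\<^sub>,\<^sub>n\<^sub>-\<^sub>1)
    + (1 - a q\<^bsup>N-1\<^esup>) (1 - a q\<^bsup>N-2\<^esup>) f\<^sub>m\<^sub>-\<^sub>1\<^sub>,\<^sub>n\<^sub>-\<^sub>1\<close>;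
  the first factorization uses \<open>c = b b'\<close>. By the recurrence
  \<open>(1 - c q\<^sup>k) w\<^sub>k\<^sub>+\<^sub>1 = (1 - a q\<^sup>k) w\<^sub>k\<close> all four terms share the factor \<open>(1 - a q\<^bsup>N-1\<^esup>) w\<^sub>N\<^sub>-\<^sub>1\<close>, and what
  remains is the recurrence for \<open>g\<close>, where \<open>c = b b'\<close> is used again.
\<close>

lemma qpoch_ratio_Suc:
  assumes "1 - c * q ^ n \<noteq> 0"
  shows "(1 - c * q ^ n) * (qpoch a q (Suc n) / qpoch c q (Suc n))
       = (1 - a * q ^ n) * (qpoch a q n / qpoch c q n)"
  using assms by (simp add: qpoch_def)

text \<open>
  The hypotheses can be rewritten as \<open>s1 - s0 = u (q s1 - b s0)\<close> and \<open>t1 - t0 = v (q t1 - b' t0)\<close>.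
  The product of these two equations, expanded, is the claim. In the application \<open>u\<close> and \<open>v\<close> are
  powers of \<open>q\<close>, and \<open>s0, s1\<close> and \<open>t0, t1\<close> are consecutive coefficients of the two \<open>q\<close>-binomial
  series.
\<close>

lemma qbinomial_product_recurrence:
  fixes q b b' u v s0 s1 t0 t1 :: complex
  assumes s: "(1 - q * u) * s1 = (1 - b * u) * s0"
    and t: "(1 - q * v) * t1 = (1 - b' * v) * t0"
  shows "(1 - q\<^sup>2 * (u * v)) * (s1 * t1) + (1 - b * b' * (u * v)) * (s0 * t0)
       = (1 - b * (q * (u * v))) * (s0 * t1) + (1 - b' * (q * (u * v))) * (s1 * t0)"
proof -
  have "s1 - s0 = u * (q * s1 - b * s0)" "t1 - t0 = v * (q * t1 - b' * t0)"
    using s t by (simp_all add: algebra_simps)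
  then have "(s1 - s0) * (t1 - t0) = u * (q * s1 - b * s0) * (v * (q * t1 - b' * t0))"
    by simp
  then show ?thesis
    by (simp add: algebra_simps power2_eq_square)
qed

lemma const2_mult_nth: "(const2 k * F) $ m $ n = k * F $ m $ n"
  by (simp add: const2_def)

lemma X2_mult_nth: "(X2 * F) $ m $ n = (if m = 0 then 0 else F $ (m - 1) $ n)"
  by (simp add: X2_def)

lemma Y2_mult_nth: "(Y2 * F) $ m $ n = (if n = 0 then 0 else F $ m $ (n - 1))"
  by (simp add: Y2_def)

theorem propositionA1:
  fixes q a b b' c :: complex and f :: fps2
  assumes q_nonzero: "q \<noteq> 0"
    and q_not_root_of_unity: "\<And>n::nat. n \<ge> 1 \<Longrightarrow> q ^ n \<noteq> 1"
    and c_nonzero: "\<And>n::nat. qpoch c q n \<noteq> 0"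
    and c_eq: "c = b * b'"
    and f_def: "f = qAppell q a b b' c"
  shows "(const2 (a * q) * X2 - const2 b') * (const2 (a * q) * Y2 - const2 b) * scale2 (q\<^sup>2) f
       - (const2 (a * q * (q + 1)) * X2 * Y2 - const2 (q * (a + b)) * X2
            - const2 (q * (a + b')) * Y2 + const2 (b * b' + q)) * scale2 q f
       + const2 q * (X2 - 1) * (Y2 - 1) * f = 0"
proof -
  define w where "w N = qpoch a q N / qpoch c q N" for N
  define s where "s m = qpoch b q m / qpoch q q m" for m
  define t where "t n = qpoch b' q n / qpoch q q n" for n
  have coeff: "f $ m $ n = w (m + n) * (s m * t n)" for m n
    by (simp add: f_def qAppell_def w_def s_def t_def mult.assoc)
  have q_factor: "1 - q * q ^ k \<noteq> 0" for k
    using q_not_root_of_unity[of "Suc k"] by simp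
  have c_factor: "1 - c * q ^ k \<noteq> 0" for k
    using c_nonzero[of "Suc k"] by (simp add: qpoch_def)
  have w_Suc: "(1 - c * q ^ k) * w (Suc k) = (1 - a * q ^ k) * w k" for k
    unfolding w_def by (rule qpoch_ratio_Suc[OF c_factor])
  have s_Suc: "(1 - q * q ^ k) * s (Suc k) = (1 - b * q ^ k) * s k" for k
    unfolding s_def by (rule qpoch_ratio_Suc[OF q_factor])
  have t_Suc: "(1 - q * q ^ k) * t (Suc k) = (1 - b' * q ^ k) * t k" for k
    unfolding t_def by (rule qpoch_ratio_Suc[OF q_factor])
  have const2_simps: "const2 (k * l) = const2 k * const2 l" "const2 (k + l) = const2 k + const2 l"
    for k l
    by (simp_all add: const2_def)
  \<comment> \<open>All polynomial factors are expanded, so that each summand is a monomial times a series.\<close>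
  have expand: "(const2 (a * q) * X2 - const2 b') * (const2 (a * q) * Y2 - const2 b) * F2
       - (const2 (a * q * (q + 1)) * X2 * Y2 - const2 (q * (a + b)) * X2
            - const2 (q * (a + b')) * Y2 + const2 (b * b' + q)) * F1
       + const2 q * (X2 - 1) * (Y2 - 1) * F0
     = X2 * (Y2 * (const2 (a * q * (a * q)) * F2 - const2 (a * q * (q + 1)) * F1 + const2 q * F0))
       - X2 * (const2 (a * q * b) * F2 - const2 (q * (a + b)) * F1 + const2 q * F0)
       - Y2 * (const2 (a * q * b') * F2 - const2 (q * (a + b')) * F1 + const2 q * F0)
       + (const2 (b * b') * F2 - const2 (b * b' + q) * F1 + const2 q * F0)" for F0 F1 F2
    by (simp add: const2_simps algebra_simps)
  note nth = fps_add_nth fps_sub_nth X2_mult_nth Y2_mult_nth const2_mult_nth scale2_nth coeff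
  show ?thesis (is "?L = 0")
  proof (rule fps_ext, rule fps_ext)
    fix m n
    have "?L $ m $ n = 0"
    proof (cases m)
      case 0
      show ?thesis
      proof (cases n)
        case 0
        then show ?thesis
          using \<open>m = 0\<close> unfolding expand nth
          by (simp add: algebra_simps)
      next
        case (Suc j)
        define v where "v = q ^ j"
        have "?L $ m $ n = q * ((1 - q * v) * t (Suc j) * ((1 - c * v) * w (Suc j))
            - (1 - a * v) * w j * ((1 - b' * v) * t j)) * s 0"
          using \<open>m = 0\<close> Suc unfolding expand nth
          by (simp add: c_eq v_def
              power_mult power2_eq_square power_mult_distrib algebra_simps)
        also have "\<dots> = 0"
          using w_Suc[of j] t_Suc[of j] by (simp add: v_def)
        finally show ?thesis .
      qed
    next
      case (Suc i)
      define u where "u = q ^ i"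
      show ?thesis
      proof (cases n)
        case 0
        have "?L $ m $ n = q * ((1 - q * u) * s (Suc i) * ((1 - c * u) * w (Suc i))
            - (1 - a * u) * w i * ((1 - b * u) * s i)) * t 0"
          using \<open>n = 0\<close> \<open>m = Suc i\<close> unfolding expand nth
          by (simp add: c_eq u_def
              power_mult power2_eq_square power_mult_distrib algebra_simps)
        also have "\<dots> = 0"
          using w_Suc[of i] s_Suc[of i] by (simp add: u_def)
        finally show ?thesis .
      next
        case (Suc j)
        define z where "z = q ^ (i + j)"
        have "?L $ m $ n = q *
            ((1 - q\<^sup>2 * z) * ((1 - c * (q * z)) * w (Suc (Suc (i + j)))) * (s (Suc i) * t (Suc j))
             + (1 - a * (q * z)) * ((1 - a * z) * w (i + j)) * (s i * t j)
             - (1 - a * (q * z)) * w (Suc (i + j)) *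
               ((1 - b * (q * z)) * (s i * t (Suc j)) + (1 - b' * (q * z)) * (s (Suc i) * t j)))"
          using \<open>n = Suc j\<close> \<open>m = Suc i\<close> unfolding expand nth
          by (simp add: c_eq z_def
              power_mult power_add power2_eq_square power_mult_distrib algebra_simps)
        also have "\<dots> = q * ((1 - a * (q * z)) * w (Suc (i + j)) *
            ((1 - q\<^sup>2 * z) * (s (Suc i) * t (Suc j)) + (1 - c * z) * (s i * t j)
             - ((1 - b * (q * z)) * (s i * t (Suc j)) + (1 - b' * (q * z)) * (s (Suc i) * t j))))"
        proof -
          have w1: "(1 - c * (q * z)) * w (Suc (Suc (i + j))) = (1 - a * (q * z)) * w (Suc (i + j))"
            using w_Suc[of "Suc (i + j)"] by (simp add: z_def)
          have w0: "(1 - a * z) * w (i + j) = (1 - c * z) * w (Suc (i + j))"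
            using w_Suc[of "i + j"] by (simp add: z_def)
          show ?thesis
            unfolding w1 w0 by (simp add: algebra_simps)
        qed
        also have "\<dots> = 0"
          using qbinomial_product_recurrence[OF s_Suc[of i] t_Suc[of j]]
          by (simp add: c_eq z_def power_add)
        finally show ?thesis .
      qed
    qed
    then show "?L $ m $ n = 0 $ m $ n"
      by simp
  qed
qed

end
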